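(* Let $\mathbb{K}$ be an algebraically closed field of characteristic zero, let $\Gamma$ be a finite, simple, connected, undirected graph without loops with vertex set $V=\{1,\dots,n\}$, $n\ge 2$, and let $\mathcal{A}\in\{\mathcal{A}_\Gamma,\mathcal{A}_{RW(\Gamma)}\}$ be one of the two evolution $\mathbb{K}$-algebras associated to $\Gamma$. Let $\mathcal{D}\le\operatorname{Aut}(\mathcal{A})$ be the diagonal subgroup. If every element of $\operatorname{Aut}(\mathcal{A})$ is induced by a symmetry of $\Gamma$, then $$\operatorname{Aut}(\mathcal{A})=\bigsqcup_{f\in\mathcal{D}}O_f$$ (a disjoint union). Moreover, $\operatorname{Aut}(\mathcal{A})$ is finite and $|\operatorname{Aut}(\mathcal{A})|=|\mathcal{D}|\,|\operatorname{Sym}(\Gamma)|$.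
   Context: For $i\in V$, $\mathcal{N}(i)=\{j\in V : \{i,j\}\text{ is an edge of }\Gamma\}$ and $d_i=|\mathcal{N}(i)|$. $\mathcal{A}_\Gamma$ is the $\mathbb{K}$-algebra with basis $B=\{e_1,\dots,e_n\}$ and bilinear product determined by $e_ie_j=0$ for $i\ne j$ and $e_i^2=\sum_{k\in\mathcal{N}(i)}e_k$. $\mathcal{A}_{RW(\Gamma)}$ is the $\mathbb{K}$-algebra with basis $B=\{e_1,\dots,e_n\}$ and bilinear product determined by $e_ie_j=0$ for $i\neq j$ and $e_i^2=\frac{1}{d_i}\sum_{k\in\mathcal{N}(i)}e_k$. $\operatorname{Aut}(\mathcal{A})$ is the group of bijective $\mathbb{K}$-linear maps $f:\mathcal{A}\to\mathcal{A}$ with $f(xy)=f(x)f(y)$ for all $x,y$. The diagonal subgroup $\mathcal{D}\le\operatorname{Aut}(\mathcal{A})$ is the set of $f\in\operatorname{Aut}(\mathcal{A})$ such that for every $i\in V$, $f(e_i)=t_{ii}e_i$ for some $t_{ii}\in\mathbb{K}^*$. $\operatorname{Sym}(\Gamma)\le S_n$ is the group of permutations $\sigma$ of $V$ such that $i\in\mathcal{N}(j)$ if and only if $\sigma(i)\in\mathcal{N}(\sigma(j))$. An automorphism $f\in\operatorname{Aut}(\mathcal{A})$ is induced by a symmetry of $\Gamma$ if there are $\sigma\in\operatorname{Sym}(\Gamma)$ and $\mu_1,\dots,\mu_n\in\mathbb{K}^*$ with $f(e_i)=\mu_ie_{\sigma(i)}$ for all $i$. For $f\in\operatorname{Aut}(\mathcal{A})$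 with $f(e_i)=\sum_{k=1}^n t_{ik}e_k$ and $\sigma\in\operatorname{Sym}(\Gamma)$, $f_{\langle\sigma\rangle}$ denotes the linear map with $f_{\langle\sigma\rangle}(e_i)=\sum_{k=1}^n t_{ik}e_{\sigma(k)}$; it belongs to $\operatorname{Aut}(\mathcal{A})$, and $(\sigma,f)\mapsto f_{\langle\sigma\rangle}$ is an action of $\operatorname{Sym}(\Gamma)$ on the set $\operatorname{Aut}(\mathcal{A})$. $O_f=\{f_{\langle\sigma\rangle}:\sigma\in\operatorname{Sym}(\Gamma)\}$ is the orbit of $f$. *)

theory Defs
  imports "HOL-Analysis.Analysis"
begin

text \<open>
  A graph is given by its set of edges; the vertex set is the finite type \<open>'n\<close>, so that
  the number of vertices is \<open>CARD('n)\<close>. Edges being two-element sets, the graph is undirected,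
  without loops and without multiple edges.
\<close>

definition simple_graph :: "'n::finite set set \<Rightarrow> bool" where
  "simple_graph E \<longleftrightarrow> (\<forall>e\<in>E. card e = 2)"

definition nbrs :: "'n::finite set set \<Rightarrow> 'n \<Rightarrow> 'n set" where
  "nbrs E i = {j. {i, j} \<in> E}"

definition degr :: "'n::finite set set \<Rightarrow> 'n \<Rightarrow> nat" where
  "degr E i = card (nbrs E i)"

definition connected_graph :: "'n::finite set set \<Rightarrow> bool" where
  "connected_graph E \<longleftrightarrow> (\<forall>i j. (i, j) \<in> {(u, v). v \<in> nbrs E u}\<^sup>*)"

definition Sym :: "'n::finite set set \<Rightarrow> ('n \<Rightarrow> 'n) set" where
  "Sym E = {\<sigma>. bij \<sigma> \<and> (\<forall>i j. i \<in> nbrs E j \<longleftrightarrow> \<sigma> i \<in> nbrs E (\<sigma> j))}"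

text \<open>
  The algebras live on the coordinate space \<open>'k ^ 'n\<close>, whose standard basis is
  \<open>bvec i = axis i 1\<close>.
\<close>

abbreviation bvec :: "'n::finite \<Rightarrow> 'k::field ^ 'n" where
  "bvec i \<equiv> axis i 1"

text \<open>
  The evolution algebra product with prescribed squares \<open>w i\<close> of the basis vectors. The
  lemmas \<open>evol_mult_props\<close> and \<open>evol_mult_unique\<close> state that it is the unique bilinear product with \<open>bvec i * bvec j = 0\<close> for
  \<open>i \<noteq> j\<close> and \<open>bvec i * bvec i = w i\<close>.
\<close>

definition bilinear_product :: "('k::field ^ 'n::finite \<Rightarrow> 'k ^ 'n \<Rightarrow> 'k ^ 'n) \<Rightarrow> bool" where
  "bilinear_product m \<longleftrightarrow>
     (\<forall>x. Vector_Spaces.linear (*s) (*s) (\<lambda>y. m x y)) \<and>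
     (\<forall>y. Vector_Spaces.linear (*s) (*s) (\<lambda>x. m x y))"

definition evol_mult :: "('n::finite \<Rightarrow> 'k::field ^ 'n) \<Rightarrow> 'k ^ 'n \<Rightarrow> 'k ^ 'n \<Rightarrow> 'k ^ 'n" where
  "evol_mult w x y = (\<Sum>i\<in>UNIV. (x $ i * y $ i) *s w i)"

lemma linear_cartI:
  assumes "\<And>x y. f (x + y) = f x + f y" "\<And>c x. f (c *s x) = c *s f x"
  shows "Vector_Spaces.linear (*s) (*s) (f :: 'k::field ^ 'n::finite \<Rightarrow> 'k ^ 'n)"
  using assms by (unfold_locales) (simp_all add: vec.scale_right_distrib vec.scale_left_distrib)

lemma evol_mult_props:
  fixes w :: "'n::finite \<Rightarrow> 'k::field ^ 'n"
  shows "bilinear_product (evol_mult w)"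
    and "evol_mult w (bvec i) (bvec j) = (if i = j then w i else 0)"
proof -
  show "bilinear_product (evol_mult w)"
    unfolding bilinear_product_def
    by (intro conjI allI linear_cartI)
      (simp_all add: evol_mult_def algebra_simps sum.distrib vec_eq_iff sum_distrib_left)
  have "evol_mult w (bvec i) (bvec j) = (\<Sum>k\<in>UNIV. if k = i then (if i = j then w i else 0) else 0)"
    unfolding evol_mult_def by (rule sum.cong) (auto simp: axis_def)
  then show "evol_mult w (bvec i) (bvec j) = (if i = j then w i else 0)" by simp
qed

lemma evol_mult_unique:
  fixes w :: "'n::finite \<Rightarrow> 'k::field ^ 'n"
  assumes bil: "bilinear_product m" and tab: "\<And>i j. m (bvec i) (bvec j) = (if i = j then w i else 0)"
  shows "m = evol_mult w"
proof (intro ext)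
  fix x y :: "'k ^ 'n"
  have l1: "Vector_Spaces.linear (*s) (*s) (\<lambda>y. m x y)" for x
    using bil unfolding bilinear_product_def by blast
  have l2: "Vector_Spaces.linear (*s) (*s) (\<lambda>x. m x y)" for y
    using bil unfolding bilinear_product_def by blast
  have "m x y = m (\<Sum>i\<in>UNIV. x $ i *s bvec i) (\<Sum>j\<in>UNIV. y $ j *s bvec j)"
    by (simp only: basis_expansion)
  also have "\<dots> = (\<Sum>i\<in>UNIV. x $ i *s (\<Sum>j\<in>UNIV. y $ j *s m (bvec i) (bvec j)))"
    by (simp only: vec.linear_sum[OF l2] vec.linear_scale[OF l2])
      (simp only: vec.linear_sum[OF l1] vec.linear_scale[OF l1])
  also have "\<dots> = (\<Sum>i\<in>UNIV. x $ i *s (\<Sum>j\<in>UNIV. if j = i then y $ i *s w i else 0))"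
    unfolding tab by (intro sum.cong arg_cong2[where f = "(*s)"] refl) auto
  also have "\<dots> = evol_mult w x y"
    by (simp add: evol_mult_def vec_eq_iff mult.assoc)
  finally show "m x y = evol_mult w x y" .
qed

definition graph_mult :: "'n::finite set set \<Rightarrow> 'k::field ^ 'n \<Rightarrow> 'k ^ 'n \<Rightarrow> 'k ^ 'n" where
  "graph_mult E = evol_mult (\<lambda>i. \<Sum>k\<in>nbrs E i. bvec k)"

definition rw_mult :: "'n::finite set set \<Rightarrow> 'k::field ^ 'n \<Rightarrow> 'k ^ 'n \<Rightarrow> 'k ^ 'n" where
  "rw_mult E = evol_mult (\<lambda>i. (1 / of_nat (degr E i)) *s (\<Sum>k\<in>nbrs E i. bvec k))"

definition Aut :: "('k::field ^ 'n::finite \<Rightarrow> 'k ^ 'n \<Rightarrow> 'k ^ 'n) \<Rightarrow> ('k ^ 'n \<Rightarrow> 'k ^ 'n) set" where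
  "Aut m = {f. Vector_Spaces.linear (*s) (*s) f \<and> bij f \<and> (\<forall>x y. f (m x y) = m (f x) (f y))}"

definition diag_Aut :: "('k::field ^ 'n::finite \<Rightarrow> 'k ^ 'n \<Rightarrow> 'k ^ 'n) \<Rightarrow> ('k ^ 'n \<Rightarrow> 'k ^ 'n) set" where
  "diag_Aut m = {f \<in> Aut m. \<forall>i. \<exists>t. t \<noteq> 0 \<and> f (bvec i) = t *s bvec i}"

definition induced_by_symmetry :: "'n::finite set set \<Rightarrow> ('k::field ^ 'n \<Rightarrow> 'k ^ 'n) \<Rightarrow> bool" where
  "induced_by_symmetry E f \<longleftrightarrow>
     (\<exists>\<sigma>\<in>Sym E. \<exists>\<mu>. (\<forall>i. \<mu> i \<noteq> 0) \<and> (\<forall>i. f (bvec i) = \<mu> i *s bvec (\<sigma> i)))"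

text \<open>
  \<open>twist \<sigma> f\<close> is the linear map sending \<open>bvec i\<close> to the sum of the \<open>t i k *s bvec (\<sigma> k)\<close>, where
  \<open>t i k = f (bvec i) $ k\<close>.
\<close>

definition twist :: "('n::finite \<Rightarrow> 'n) \<Rightarrow> ('k::field ^ 'n \<Rightarrow> 'k ^ 'n) \<Rightarrow> 'k ^ 'n \<Rightarrow> 'k ^ 'n" where
  "twist \<sigma> f x = (\<Sum>i\<in>UNIV. x $ i *s (\<Sum>k\<in>UNIV. (f (bvec i) $ k) *s bvec (\<sigma> k)))"

lemma twist_props:
  fixes f :: "'k::field ^ 'n::finite \<Rightarrow> 'k ^ 'n"
  shows "Vector_Spaces.linear (*s) (*s) (twist \<sigma> f)"
    and "twist \<sigma> f (bvec i) = (\<Sum>k\<in>UNIV. (f (bvec i) $ k) *s bvec (\<sigma> k))"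
proof -
  show "Vector_Spaces.linear (*s) (*s) (twist \<sigma> f)"
    by (rule linear_cartI)
      (simp_all only: twist_def vec.scale_left_distrib sum.distrib vec.scale_sum_right
        vec.scale_scale vector_add_component vector_smult_component mult.assoc distrib_right)
  have "twist \<sigma> f (bvec i) =
      (\<Sum>j\<in>UNIV. if j = i then (\<Sum>k\<in>UNIV. (f (bvec i) $ k) *s bvec (\<sigma> k)) else 0)"
    unfolding twist_def by (rule sum.cong) (auto simp: axis_def)
  then show "twist \<sigma> f (bvec i) = (\<Sum>k\<in>UNIV. (f (bvec i) $ k) *s bvec (\<sigma> k))" by simp
qed

definition orbit_of :: "'n::finite set set \<Rightarrow> ('k::field ^ 'n \<Rightarrow> 'k ^ 'n) \<Rightarrow> ('k ^ 'n \<Rightarrow> 'k ^ 'n) set" where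
  "orbit_of E f = {twist \<sigma> f | \<sigma>. \<sigma> \<in> Sym E}"

end

theory Submission
  imports Defs
begin

text \<open>
  Twisting by \<open>\<sigma>\<close> is composition with the automorphism permuting the basis along \<open>\<sigma>\<close>. Hence an
  automorphism \<open>e\<^sub>i \<mapsto> \<mu>\<^sub>i e\<^bsub>\<sigma>(i)\<^esub>\<close> is the twist by \<open>\<sigma>\<close> of a diagonal one, and both \<open>\<sigma>\<close> and the
  diagonal part can be read off, so that \<open>(f, \<sigma>) \<mapsto> f\<^bsub>\<langle>\<sigma>\<rangle>\<^esub>\<close> is a bijection from
  \<open>\<D> \<times> Sym(\<Gamma>)\<close> onto the automorphism group. Finiteness comes from the diagonal subgroup: if
  \<open>i\<close> and \<open>k\<close> are adjacent, then \<open>t\<^sub>k = t\<^sub>i\<^sup>2\<close> and \<open>t\<^sub>i = t\<^sub>k\<^sup>2\<close>, so every diagonal entry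
  is a cube root of unity.
\<close>

section \<open>Linear maps and scaled basis vectors\<close>

lemma linear_eq_on_bvec:
  fixes f g :: "'k::field ^ 'n::finite \<Rightarrow> 'k ^ 'n"
  assumes "Vector_Spaces.linear (*s) (*s) f" "Vector_Spaces.linear (*s) (*s) g"
    and "\<And>i. f (bvec i) = g (bvec i)"
  shows "f = g"
proof
  fix x
  have "f (\<Sum>i\<in>UNIV. x $ i *s bvec i) = g (\<Sum>i\<in>UNIV. x $ i *s bvec i)"
    by (simp only: vec.linear_sum[OF assms(1)] vec.linear_sum[OF assms(2)]
        vec.linear_scale[OF assms(1)] vec.linear_scale[OF assms(2)] assms(3))
  then show "f x = g x" by (simp only: basis_expansion)
qed

lemma scaled_bvec_eq_iff:
  fixes a b :: "'k::field"
  assumes "a \<noteq> 0"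
  shows "a *s bvec i = b *s bvec j \<longleftrightarrow> a = b \<and> i = j"
  using assms by (auto simp: vec_eq_iff axis_def split: if_splits)

section \<open>Coordinate permutations and twists\<close>

definition perm_vec :: "('n::finite \<Rightarrow> 'n) \<Rightarrow> 'k::field ^ 'n \<Rightarrow> 'k ^ 'n" where
  "perm_vec \<sigma> x = (\<chi> j. x $ inv \<sigma> j)"

lemma linear_perm_vec: "Vector_Spaces.linear (*s) (*s) (perm_vec \<sigma>)"
  by (rule linear_cartI) (simp_all add: perm_vec_def vec_eq_iff)

text \<open>Because coordinates are read through \<open>inv \<sigma>\<close>, the only nonzero one
  of the image sits at \<open>\<sigma> k\<close>: basis vectors move along \<open>\<sigma>\<close>
  itself.\<close>

lemma perm_vec_bvec:
  assumes "bij \<sigma>"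
  shows "perm_vec \<sigma> (bvec k) = bvec (\<sigma> k)"
proof -
  have "inv \<sigma> j = k \<longleftrightarrow> j = \<sigma> k" for j
    using assms by (metis bij_inv_eq_iff)
  then show ?thesis by (simp add: perm_vec_def vec_eq_iff axis_def)
qed

lemma bij_perm_vec:
  assumes "bij \<sigma>"
  shows "bij (perm_vec \<sigma> :: 'k::field ^ 'n::finite \<Rightarrow> 'k ^ 'n)"
proof (rule o_bij)
  show "(\<lambda>x. \<chi> j. x $ \<sigma> j) \<circ> perm_vec \<sigma> = (id :: 'k ^ 'n \<Rightarrow> 'k ^ 'n)"
    using assms by (auto simp: perm_vec_def fun_eq_iff vec_eq_iff bij_is_inj)
  show "perm_vec \<sigma> \<circ> (\<lambda>x. \<chi> j. x $ \<sigma> j) = (id :: 'k ^ 'n \<Rightarrow> 'k ^ 'n)"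
    using assms by (auto simp: perm_vec_def fun_eq_iff vec_eq_iff bij_is_surj surj_f_inv_f)
qed

text \<open>Reindexing the sum that defines the product along \<open>\<sigma>\<close> reduces
  multiplicativity to the compatibility of the squares \<open>w i\<close> with the
  permutation.\<close>

lemma perm_vec_Aut:
  fixes w :: "'n::finite \<Rightarrow> 'k::field ^ 'n"
  assumes "bij \<sigma>" and w: "\<And>i. w (\<sigma> i) = perm_vec \<sigma> (w i)"
  shows "perm_vec \<sigma> \<in> Aut (evol_mult w)"
proof -
  have "perm_vec \<sigma> (evol_mult w x y) = evol_mult w (perm_vec \<sigma> x) (perm_vec \<sigma> y)" for x y
  proof -
    have "evol_mult w (perm_vec \<sigma> x) (perm_vec \<sigma> y)
        = (\<Sum>i\<in>UNIV. (perm_vec \<sigma> x $ \<sigma> i * perm_vec \<sigma> y $ \<sigma> i) *s w (\<sigma> i))"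
      unfolding evol_mult_def using assms(1) by (rule sum.reindex_bij_betw[symmetric])
    also have "\<dots> = (\<Sum>i\<in>UNIV. (x $ i * y $ i) *s perm_vec \<sigma> (w i))"
      using assms(1) by (simp add: w) (simp add: perm_vec_def bij_is_inj)
    also have "\<dots> = perm_vec \<sigma> (evol_mult w x y)"
      unfolding evol_mult_def
      by (simp only: vec.linear_sum[OF linear_perm_vec] vec.linear_scale[OF linear_perm_vec])
    finally show ?thesis by simp
  qed
  then show ?thesis
    using linear_perm_vec bij_perm_vec[OF assms(1)] by (auto simp: Aut_def)
qed

lemma Aut_comp:
  assumes "f \<in> Aut m" "g \<in> Aut m"
  shows "f \<circ> g \<in> Aut m"
  using assms unfolding Aut_def
  by (auto intro: bij_comp Vector_Spaces.linear_compose)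

text \<open>A twist relabels the target basis and keeps the coefficients. As a composition it is
  seen to be an automorphism once both factors are.\<close>

lemma twist_eq_comp:
  fixes f :: "'k::field ^ 'n::finite \<Rightarrow> 'k ^ 'n"
  assumes "Vector_Spaces.linear (*s) (*s) f" "bij \<sigma>"
  shows "twist \<sigma> f = perm_vec \<sigma> \<circ> f"
proof (rule linear_eq_on_bvec)
  show "Vector_Spaces.linear (*s) (*s) (perm_vec \<sigma> \<circ> f)"
    using assms(1) linear_perm_vec by (rule Vector_Spaces.linear_compose)
  show "twist \<sigma> f (bvec i) = (perm_vec \<sigma> \<circ> f) (bvec i)" for i
  proof -
    have "perm_vec \<sigma> (f (bvec i)) = perm_vec \<sigma> (\<Sum>k\<in>UNIV. (f (bvec i) $ k) *s bvec k)"
      by (simp only: basis_expansion)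
    then show ?thesis
      by (simp add: twist_props(2) vec.linear_sum[OF linear_perm_vec]
          vec.linear_scale[OF linear_perm_vec] perm_vec_bvec[OF assms(2)])
  qed
qed (rule twist_props)

lemma twist_diag_bvec:
  assumes "bij \<sigma>" "Vector_Spaces.linear (*s) (*s) f" "f (bvec i) = t *s bvec i"
  shows "twist \<sigma> f (bvec i) = t *s bvec (\<sigma> i)"
  using assms
  by (simp add: twist_eq_comp vec.linear_scale[OF linear_perm_vec] perm_vec_bvec)

section \<open>Symmetries of the graph\<close>

lemma Sym_bij: "\<sigma> \<in> Sym E \<Longrightarrow> bij \<sigma>"
  by (simp add: Sym_def)

lemma inv_Sym:
  assumes "\<sigma> \<in> Sym E"
  shows "inv \<sigma> \<in> Sym E"
proof -
  have "i \<in> nbrs E j \<longleftrightarrow> inv \<sigma> i \<in> nbrs E (inv \<sigma> j)" for i j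
  proof -
    have "inv \<sigma> i \<in> nbrs E (inv \<sigma> j) \<longleftrightarrow> \<sigma> (inv \<sigma> i) \<in> nbrs E (\<sigma> (inv \<sigma> j))"
      using assms unfolding Sym_def by blast
    then show ?thesis
      by (simp add: surj_f_inv_f[OF bij_is_surj[OF Sym_bij[OF assms]]])
  qed
  then show ?thesis
    using bij_imp_bij_inv[OF Sym_bij[OF assms]] by (simp add: Sym_def)
qed

lemma nbrs_Sym:
  assumes "\<sigma> \<in> Sym E"
  shows "nbrs E (\<sigma> i) = \<sigma> ` nbrs E i"
proof
  show "\<sigma> ` nbrs E i \<subseteq> nbrs E (\<sigma> i)"
    using assms by (auto simp: Sym_def)
  show "nbrs E (\<sigma> i) \<subseteq> \<sigma> ` nbrs E i"
  proof
    fix k assume k: "k \<in> nbrs E (\<sigma> i)"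
    obtain l where "k = \<sigma> l" using Sym_bij[OF assms] by (metis bij_pointE)
    with k assms show "k \<in> \<sigma> ` nbrs E i" by (auto simp: Sym_def)
  qed
qed

lemma degr_Sym:
  assumes "\<sigma> \<in> Sym E"
  shows "degr E (\<sigma> i) = degr E i"
  using Sym_bij[OF assms] unfolding degr_def nbrs_Sym[OF assms]
  by (intro card_image) (auto intro: inj_on_subset bij_is_inj)

lemma finite_Sym: "finite (Sym E)"
  by simp

lemma nbrs_commute: "j \<in> nbrs E i \<longleftrightarrow> i \<in> nbrs E j"
  by (simp add: nbrs_def insert_commute)

text \<open>There is a second vertex, and a path leading to it must begin with an edge at
  \<open>i\<close>.\<close>

lemma nbrs_nonempty:
  fixes E :: "'n::finite set set"
  assumes "CARD('n) \<ge> 2" "connected_graph E"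
  shows "nbrs E i \<noteq> {}"
proof -
  have "\<exists>j. j \<noteq> i"
  proof (rule ccontr)
    assume "\<nexists>j. j \<noteq> i"
    then have "(UNIV :: 'n set) = {i}" by auto
    then have "CARD('n) = card {i}" by (rule arg_cong)
    then show False using assms(1) by simp
  qed
  then obtain j where "j \<noteq> i" by blast
  moreover have "(i, j) \<in> {(u, v). v \<in> nbrs E u}\<^sup>*"
    using assms(2) by (simp add: connected_graph_def)
  ultimately show ?thesis by (auto elim: converse_rtranclE)
qed

text \<open>
  Both products are treated at once: in either algebra, the square of a basis vector is the sum of
  its neighbours times a factor that is invariant under symmetries.
\<close>

definition weighted_mult :: "('n::finite \<Rightarrow> 'k) \<Rightarrow> 'n set set \<Rightarrow> 'k::field ^ 'n \<Rightarrow> 'k ^ 'n \<Rightarrow> 'k ^ 'n"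
  where "weighted_mult c E = evol_mult (\<lambda>i. c i *s (\<Sum>k\<in>nbrs E i. bvec k))"

lemma graph_mult_eq: "graph_mult E = weighted_mult (\<lambda>_. 1) E"
  by (simp add: graph_mult_def weighted_mult_def)

lemma rw_mult_eq: "rw_mult E = weighted_mult (\<lambda>i. 1 / of_nat (degr E i)) E"
  by (simp add: rw_mult_def weighted_mult_def)

text \<open>A symmetry carries neighbourhoods to neighbourhoods and preserves the weights, so it
  carries the square of \<open>bvec i\<close> to that of \<open>bvec (\<sigma> i)\<close>.\<close>

lemma perm_vec_Aut_weighted_mult:
  assumes \<sigma>: "\<sigma> \<in> Sym E" and c: "\<And>i. c (\<sigma> i) = c i"
  shows "perm_vec \<sigma> \<in> Aut (weighted_mult c E)"
  unfolding weighted_mult_def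
proof (rule perm_vec_Aut)
  show "bij \<sigma>" using \<sigma> by (rule Sym_bij)
  then have "inj_on \<sigma> (nbrs E i)" for i
    by (auto intro: inj_on_subset bij_is_inj)
  then show "c (\<sigma> i) *s (\<Sum>k\<in>nbrs E (\<sigma> i). bvec k) = perm_vec \<sigma> (c i *s (\<Sum>k\<in>nbrs E i. bvec k))" for i
    using \<open>bij \<sigma>\<close>
    by (simp add: c nbrs_Sym[OF \<sigma>] sum.reindex vec.linear_scale[OF linear_perm_vec]
        vec.linear_sum[OF linear_perm_vec] perm_vec_bvec)
qed

section \<open>Diagonal automorphisms\<close>

lemma sum_bvec_component:
  fixes A :: "'n::finite set"
  shows "(\<Sum>k\<in>A. t k *s bvec k) $ j = (if j \<in> A then t j else (0 :: 'k::field))"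
  by (simp add: axis_def if_distrib cong: if_cong)

text \<open>Applying \<open>f\<close> to the square of \<open>bvec i\<close> and comparing
  coefficients at \<open>k\<close> gives \<open>c i * t k = (t i)\<^sup>2 * c i\<close>; then
  \<open>c i\<close> cancels.\<close>

lemma diag_Aut_neighbour:
  fixes f :: "'k::field ^ 'n::finite \<Rightarrow> 'k ^ 'n"
  assumes f: "f \<in> Aut (weighted_mult c E)" and t: "\<And>i. f (bvec i) = t i *s bvec i"
    and k: "k \<in> nbrs E i" and c: "c i \<noteq> 0"
  shows "t k = (t i)\<^sup>2"
proof -
  have lin: "Vector_Spaces.linear (*s) (*s) f" using f by (simp add: Aut_def)
  define s where "s = (\<Sum>k\<in>nbrs E i. bvec k :: 'k ^ 'n)"
  \<comment> \<open>A general scalar \<open>a\<close> covers both uses: \<open>a = 1\<close> before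
    applying \<open>f\<close> and \<open>a = t i\<close> after.\<close>
  have sq: "weighted_mult c E (a *s bvec i) (a *s bvec i) = (a\<^sup>2 * c i) *s s" for a
  proof -
    have "weighted_mult c E (a *s bvec i) (a *s bvec i)
        = (\<Sum>j\<in>UNIV. if j = i then (a\<^sup>2 * c i) *s s else 0)"
      unfolding weighted_mult_def evol_mult_def s_def
      by (rule sum.cong) (auto simp: axis_def power2_eq_square)
    then show ?thesis by simp
  qed
  have "c i *s f s = f (weighted_mult c E (bvec i) (bvec i))"
    using sq[of 1] by (simp add: vec.linear_scale[OF lin])
  also have "\<dots> = weighted_mult c E (t i *s bvec i) (t i *s bvec i)"
    using f by (simp add: Aut_def t)
  finally have eq: "c i *s f s = ((t i)\<^sup>2 * c i) *s s" by (simp only: sq)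
  have "f s = (\<Sum>k\<in>nbrs E i. t k *s bvec k)"
    by (simp add: s_def vec.linear_sum[OF lin] t)
  then have "f s $ k = t k" using k by (simp only: sum_bvec_component if_True)
  moreover have "s $ k = 1"
    using k sum_bvec_component[of "\<lambda>_. 1" "nbrs E i" k] by (simp add: s_def)
  ultimately show ?thesis
    using arg_cong[OF eq, of "\<lambda>v. v $ k"] c by simp
qed

lemma diag_Aut_cube_root:
  assumes "f \<in> Aut (weighted_mult c E)" "\<And>i. f (bvec i) = t i *s bvec i"
    and "t i \<noteq> 0" "\<And>i. c i \<noteq> 0" "nbrs E i \<noteq> {}"
  shows "t i ^ 3 = 1"
proof -
  obtain k where k: "k \<in> nbrs E i" using assms(5) by blast
  have "t i = (t k)\<^sup>2" "t k = (t i)\<^sup>2"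
    using diag_Aut_neighbour[OF assms(1,2)] k assms(4) nbrs_commute by blast+
  \<comment> \<open>Going to the neighbour and back along the same edge squares the entry twice;
    cancelling one factor \<open>t i\<close> leaves the cube.\<close>
  then have "t i = ((t i)\<^sup>2)\<^sup>2" by simp
  also have "\<dots> = t i * t i ^ 3"
    by (simp add: power2_eq_square power3_eq_cube mult.assoc)
  finally show ?thesis using assms(3) by simp
qed

lemma finite_roots_of_one:
  assumes "n > 0"
  shows "finite {x :: 'a::idom. x ^ n = 1}"
proof -
  have "monom 1 n - 1 \<noteq> (0 :: 'a poly)"
    \<comment> \<open>The coefficient of degree \<open>n\<close> is 1, since the subtracted constant
      lies in degree 0 and \<open>n > 0\<close>.\<close>
    using assms by (auto simp: poly_eq_iff dest!: spec[of _ n])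
  from poly_roots_finite[OF this] show ?thesis by (simp add: poly_monom)
qed

text \<open>Reading off the diagonal entries embeds the diagonal subgroup into the functions from
  the vertices to the finite set of cube roots of unity.\<close>

lemma finite_diag_Aut:
  fixes E :: "'n::finite set set" and c :: "'n \<Rightarrow> 'k::field"
  assumes "\<And>i. c i \<noteq> 0" "\<And>i. nbrs E i \<noteq> {}"
  shows "finite (diag_Aut (weighted_mult c E))" (is "finite ?D")
proof (rule finite_imageD)
  define entries where "entries f = (\<lambda>i. f (bvec i) $ i)" for f :: "'k ^ 'n \<Rightarrow> 'k ^ 'n"
  have entries: "f (bvec i) = entries f i *s bvec i" "entries f i \<noteq> 0" if f: "f \<in> ?D" for f i
  proof -
    obtain t where "t \<noteq> 0" "f (bvec i) = t *s bvec i"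
      using f unfolding diag_Aut_def by blast
    then show "f (bvec i) = entries f i *s bvec i" "entries f i \<noteq> 0"
      by (simp_all add: entries_def)
  qed
  have "entries f i ^ 3 = 1" if "f \<in> ?D" for f i
    using that entries[OF that] assms by (auto simp: diag_Aut_def intro: diag_Aut_cube_root)
  then have "entries ` ?D \<subseteq> PiE UNIV (\<lambda>_. {x. x ^ 3 = 1})"
    by auto
  moreover have "finite (PiE (UNIV :: 'n set) (\<lambda>_. {x :: 'k. x ^ 3 = 1}))"
    by (intro finite_PiE finite_roots_of_one) simp_all
  ultimately show "finite (entries ` ?D)" by (rule finite_subset)
  show "inj_on entries ?D"
  proof (rule inj_onI)
    fix f g assume fg: "f \<in> ?D" "g \<in> ?D" "entries f = entries g"
    then show "f = g"
      using entries(1)[OF fg(1)] entries(1)[OF fg(2)]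
      by (intro linear_eq_on_bvec) (auto simp: diag_Aut_def Aut_def)
  qed
qed

section \<open>Decomposition of the automorphism group\<close>

lemma inj_on_twist_diag:
  fixes m :: "'k::field ^ 'n::finite \<Rightarrow> 'k ^ 'n \<Rightarrow> 'k ^ 'n"
  shows "inj_on (\<lambda>(f, \<sigma>). twist \<sigma> f) (diag_Aut m \<times> Sym E)"
proof (rule inj_onI, clarsimp)
  fix f g :: "'k ^ 'n \<Rightarrow> 'k ^ 'n" and \<sigma> \<tau>
  assume f: "f \<in> diag_Aut m" and g: "g \<in> diag_Aut m" and \<sigma>: "\<sigma> \<in> Sym E" and \<tau>: "\<tau> \<in> Sym E"
    and eq: "twist \<sigma> f = twist \<tau> g"
  have lin: "Vector_Spaces.linear (*s) (*s) f" "Vector_Spaces.linear (*s) (*s) g"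
    using f g by (simp_all add: diag_Aut_def Aut_def)
  have "f (bvec i) = g (bvec i) \<and> \<sigma> i = \<tau> i" for i
  proof -
    obtain a where a: "a \<noteq> 0" "f (bvec i) = a *s bvec i" using f unfolding diag_Aut_def by blast
    obtain b where b: "g (bvec i) = b *s bvec i" using g unfolding diag_Aut_def by blast
    \<comment> \<open>As \<open>a\<close> is nonzero, this one vector determines both the diagonal
      entry and the image of \<open>i\<close>.\<close>
    have "a *s bvec (\<sigma> i) = b *s bvec (\<tau> i)"
      using twist_diag_bvec[OF Sym_bij[OF \<sigma>] lin(1) a(2)] twist_diag_bvec[OF Sym_bij[OF \<tau>] lin(2) b] eq
      by simp
    then show ?thesis using a b by (simp add: scaled_bvec_eq_iff)
  qed
  then show "f = g \<and> \<sigma> = \<tau>" using linear_eq_on_bvec[OF lin] by auto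
qed

text \<open>Twists stay in the group because symmetries act by automorphisms; conversely, undoing
  the permutation in an induced automorphism leaves a diagonal one.\<close>

lemma twist_diag_image_Aut:
  fixes c :: "'n::finite \<Rightarrow> 'k::field"
  assumes c: "\<And>\<sigma> i. \<sigma> \<in> Sym E \<Longrightarrow> c (\<sigma> i) = c i"
    and ind: "\<And>f. f \<in> Aut (weighted_mult c E) \<Longrightarrow> induced_by_symmetry E f"
  shows "(\<lambda>(f, \<sigma>). twist \<sigma> f) ` (diag_Aut (weighted_mult c E) \<times> Sym E) = Aut (weighted_mult c E)"
    (is "?F ` (?D \<times> _) = ?A")
proof
  have perm: "perm_vec \<sigma> \<in> ?A" if "\<sigma> \<in> Sym E" for \<sigma>
    using that c[OF that] by (rule perm_vec_Aut_weighted_mult)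
  show "?F ` (?D \<times> Sym E) \<subseteq> ?A"
  proof clarsimp
    fix f \<sigma> assume "f \<in> ?D" "\<sigma> \<in> Sym E"
    then have f: "f \<in> ?A" and lin: "Vector_Spaces.linear (*s) (*s) f"
      by (simp_all add: diag_Aut_def Aut_def)
    show "twist \<sigma> f \<in> ?A"
      using Aut_comp[OF perm[OF \<open>\<sigma> \<in> Sym E\<close>] f] twist_eq_comp[OF lin Sym_bij[OF \<open>\<sigma> \<in> Sym E\<close>]]
      by simp
  qed
  show "?A \<subseteq> ?F ` (?D \<times> Sym E)"
  proof
    fix f assume f: "f \<in> ?A"
    then obtain \<sigma> \<mu> where \<sigma>: "\<sigma> \<in> Sym E"
      and \<mu>: "\<And>i. \<mu> i \<noteq> 0" "\<And>i. f (bvec i) = \<mu> i *s bvec (\<sigma> i)"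
      using ind unfolding induced_by_symmetry_def by meson
    \<comment> \<open>The diagonal part of \<open>f\<close>: the inverse symmetry returns each basis
      vector to its place and keeps the scalar \<open>\<mu> i\<close>.\<close>
    define d where "d = perm_vec (inv \<sigma>) \<circ> f"
    have d: "d \<in> ?A" unfolding d_def using perm[OF inv_Sym[OF \<sigma>]] f by (rule Aut_comp)
    have bvec: "d (bvec i) = \<mu> i *s bvec i" for i
      using Sym_bij[OF \<sigma>] bij_imp_bij_inv[OF Sym_bij[OF \<sigma>]]
      by (simp add: d_def \<mu>(2) vec.linear_scale[OF linear_perm_vec] perm_vec_bvec bij_is_inj)
    have "f = twist \<sigma> d"
    proof (rule linear_eq_on_bvec)
      show "Vector_Spaces.linear (*s) (*s) f" using f by (simp add: Aut_def)
      have "Vector_Spaces.linear (*s) (*s) d" using d by (simp add: Aut_def)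
      from twist_diag_bvec[OF Sym_bij[OF \<sigma>] this bvec]
      show "f (bvec i) = twist \<sigma> d (bvec i)" for i
        by (simp add: \<mu>(2))
    qed (rule twist_props)
    moreover have "d \<in> ?D" using d bvec \<mu>(1) by (auto simp: diag_Aut_def)
    ultimately show "f \<in> ?F ` (?D \<times> Sym E)" using \<sigma> by auto
  qed
qed

theorem theorem2p20:
  fixes E :: "'n::finite set set"
    and mul :: "'k::{alg_closed_field, field_char_0} ^ 'n \<Rightarrow> 'k ^ 'n \<Rightarrow> 'k ^ 'n"
  assumes "CARD('n) \<ge> 2"
    and "simple_graph E"
    and "connected_graph E"
    and "mul \<in> {graph_mult E, rw_mult E}"
    and "\<forall>f\<in>Aut mul. induced_by_symmetry E f"
  shows "Aut mul = (\<Union>f\<in>diag_Aut mul. orbit_of E f)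
    \<and> disjoint_family_on (orbit_of E) (diag_Aut mul)
    \<and> finite (Aut mul)
    \<and> card (Aut mul) = card (diag_Aut mul) * card (Sym E)"
proof -
  let ?F = "\<lambda>(f, \<sigma>). twist \<sigma> f :: 'k ^ 'n \<Rightarrow> 'k ^ 'n"
  have nonempty: "nbrs E i \<noteq> {}" for i using assms(1,3) by (rule nbrs_nonempty)
  then have "degr E i \<noteq> 0" for i by (simp add: degr_def)
  \<comment> \<open>The weights are constantly 1 or the reciprocal degrees. The latter are nonzero
    because degrees are positive and the characteristic is zero.\<close>
  then obtain c :: "'n \<Rightarrow> 'k" where mul: "mul = weighted_mult c E"
    and c: "\<And>i. c i \<noteq> 0" "\<And>\<sigma> i. \<sigma> \<in> Sym E \<Longrightarrow> c (\<sigma> i) = c i"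
    using assms(4) that[of "\<lambda>_. 1"] that[of "\<lambda>i. 1 / of_nat (degr E i)"]
    by (auto simp: graph_mult_eq rw_mult_eq degr_Sym)
  have inj: "inj_on ?F (diag_Aut mul \<times> Sym E)" by (rule inj_on_twist_diag)
  have image: "?F ` (diag_Aut mul \<times> Sym E) = Aut mul"
    unfolding mul using c(2) assms(5) mul by (intro twist_diag_image_Aut) auto
  have "finite (diag_Aut mul)"
    unfolding mul using c(1) nonempty by (rule finite_diag_Aut)
  then have "finite (Aut mul)"
    unfolding image[symmetric] by (intro finite_imageI finite_cartesian_product finite_Sym)
  moreover have "card (Aut mul) = card (diag_Aut mul) * card (Sym E)"
    using card_image[OF inj] by (simp add: image card_cartesian_product)
  \<comment> \<open>Grouping the image of \<open>?F\<close> by its diagonal argument gives the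
    orbits.\<close>
  moreover have "Aut mul = (\<Union>f\<in>diag_Aut mul. orbit_of E f)"
    unfolding image[symmetric] by (auto simp: orbit_of_def)
  moreover have "disjoint_family_on (orbit_of E) (diag_Aut mul)"
  proof -
    \<comment> \<open>A common element of two orbits is one value of \<open>?F\<close> at two pairs,
      so injectivity identifies their diagonal parts.\<close>
    have "f = g" if "f \<in> diag_Aut mul" "g \<in> diag_Aut mul" "\<sigma> \<in> Sym E" "\<tau> \<in> Sym E"
      "twist \<sigma> f = twist \<tau> g" for f g \<sigma> \<tau>
      using inj_onD[OF inj, of "(f, \<sigma>)" "(g, \<tau>)"] that by simp
    then show ?thesis unfolding disjoint_family_on_def orbit_of_def by blast
  qed
  ultimately show ?thesis by blast
qed

end
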